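(* Let $E\subset\mathbb{R}^d$ be a non-empty bounded Borel set. Then $$\underline{\dim}_{\rm B}E=\liminf_{R\to\infty}\frac{\log\Big(R^{-d}\inf_{\mu\in\mathcal{P}(E)}\int_{|z|\le R}|\widehat{\mu}(z)|^2\,dz\Big)}{-\log R}$$ and $$\overline{\dim}_{\rm B}E=\limsup_{R\to\infty}\frac{\log\Big(R^{-d}\inf_{\mu\in\mathcal{P}(E)}\int_{|z|\le R}|\widehat{\mu}(z)|^2\,dz\Big)}{-\log R}.$$
   Context: $\mathcal{P}(E)$ is the set of Borel probability measures on $\mathbb{R}^d$ supported by $E$, i.e. with $\mu(\mathbb{R}^d\setminus E)=0$. The Fourier transform of $\mu$ is $\widehat{\mu}(z)=\int e^{i x\cdot z}\,d\mu(x)$, $z\in\mathbb{R}^d$. For $r>0$, $N_r(E)$ is the least number of sets of diameter $r$ that can cover $E$, and the lower and upper box-counting dimensions are $\underline{\dim}_{\rm B}E=\liminf_{r\to0}\frac{\log N_r(E)}{-\log r}$ and $\overline{\dim}_{\rm B}E=\limsup_{r\to0}\frac{\log N_r(E)}{-\log r}$. *)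

theory Defs
  imports "HOL-Probability.Probability"
begin

definition prob_measures_on :: "(real ^ 'n) set \<Rightarrow> (real ^ 'n) measure set" where
  "prob_measures_on E = {\<mu>. prob_space \<mu> \<and> sets \<mu> = sets borel \<and> emeasure \<mu> (UNIV - E) = 0}"

definition fourier_measure :: "(real ^ 'n) measure \<Rightarrow> real ^ 'n \<Rightarrow> complex" where
  "fourier_measure \<mu> z = (\<integral>x. exp (\<i> * complex_of_real (x \<bullet> z)) \<partial>\<mu>)"

(* Boundedness is explicit because the library's real-valued diameter carries no
   information on unbounded sets.  Diameter exactly r and diameter at most r give the
   same number here: the covering sets are arbitrary subsets of a space of dimension
   at least 1, so a set of smaller diameter can be enlarged to one of diameter r. *)
definition covering_number :: "real \<Rightarrow> (real ^ 'n) set \<Rightarrow> nat" where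
  "covering_number r E =
     (LEAST k. \<exists>\<U>. finite \<U> \<and> card \<U> = k \<and>
        (\<forall>U\<in>\<U>. bounded U \<and> diameter U = r) \<and> E \<subseteq> \<Union>\<U>)"

definition lower_box_dim :: "(real ^ 'n) set \<Rightarrow> ereal" where
  "lower_box_dim E =
     Liminf (at_right 0) (\<lambda>r. ereal (ln (real (covering_number r E)) / (- ln r)))"

definition upper_box_dim :: "(real ^ 'n) set \<Rightarrow> ereal" where
  "upper_box_dim E =
     Limsup (at_right 0) (\<lambda>r. ereal (ln (real (covering_number r E)) / (- ln r)))"

end

theory Submission
  imports Defs
begin

text \<open>
  Write \<open>N\<close> for the covering number of \<open>E\<close> at scale \<open>1/R\<close>, \<open>d\<close> for the dimension, and
  \<open>I(R)\<close> for the infimum of the energies \<open>\<integral>\<^bsub>|z| \<le> R\<^esub> |\<mu>^|\<^sup>2\<close>. The two formulas hold because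
  \<open>R\<^sup>-\<^sup>d I(R)\<close> is comparable to \<open>1/N\<close>, with constants that depend on \<open>d\<close> only: after taking
  logarithms and dividing by \<open>ln R\<close> the constants vanish in the limit.

  The sharp cut-off to a ball is compared with a product of tent functions, which is the
  right kernel in both directions: it has compact support, so it can be dominated by the
  indicator of a ball, and its Fourier transform, a product of Fejer kernels, is
  nonnegative and decays quadratically in each coordinate, so it is summable over separated
  sets. By Fubini (\<open>tent_energy\<close>) the tent energy of \<open>\<mu>\<close> equals
  \<open>\<integral>\<integral> fejer_prod S (x - y) d\<mu>(x) d\<mu>(y)\<close>.

  Lower bound (\<open>ball_energy_ge_covering\<close>). The Fejer kernel is at least a constant times
  \<open>R\<^sup>d\<close> on pairs of points at distance at most \<open>1/R\<close>, hence on any two points of the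
  same covering set. Two independent \<open>\<mu>\<close>-random points lie in the same one of \<open>N\<close> sets
  with probability at least \<open>1/N\<close>, by Cauchy-Schwarz. This holds for every \<open>\<mu>\<close> on \<open>E\<close>.

  Upper bound (\<open>ex_ball_energy_le_covering\<close>). Let \<open>\<mu>\<close> be the uniform distribution on a
  maximal \<open>1/(2R)\<close>-separated set \<open>F \<subseteq> E\<close>. Maximality makes the balls of radius \<open>1/(2R)\<close>
  around \<open>F\<close> a cover of \<open>E\<close>, so \<open>F\<close> has at least \<open>N\<close> points; separation and the decay of
  the Fejer kernel bound each inner sum by a constant times \<open>R\<^sup>d\<close> (\<open>sum_fejer_prod_le\<close>),
  so the energy is at most a constant times \<open>R\<^sup>d/N\<close>.
\<close>

section \<open>The tent function and the Fejer kernel\<close>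

definition tent :: "real \<Rightarrow> real \<Rightarrow> real" where
  "tent S t = max 0 (1 - \<bar>t\<bar> / S)"

text \<open>
  The Fourier transform of \<open>tent S\<close>, that is \<open>S (sin (Su/2) / (Su/2))\<^sup>2\<close>, with its
  removable singularity filled in.
\<close>

definition fejer :: "real \<Rightarrow> real \<Rightarrow> real" where
  "fejer S u = (if u = 0 then S else 2 * (1 - cos (S * u)) / (S * u\<^sup>2))"

lemma tent_nonneg: "0 \<le> tent S t"
  by (simp add: tent_def)

lemma tent_le_one: "S > 0 \<Longrightarrow> tent S t \<le> 1"
  by (simp add: tent_def)

lemma tent_eq_0: "S > 0 \<Longrightarrow> S \<le> \<bar>t\<bar> \<Longrightarrow> tent S t = 0"
  by (simp add: tent_def field_simps)

lemma continuous_tent: "continuous_on A (tent S)"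
  unfolding tent_def divide_inverse by (intro continuous_intros)

lemma tent_measurable [measurable]: "tent S \<in> borel_measurable borel"
  using continuous_tent[of UNIV] by (rule borel_measurable_continuous_onI)

lemma tent_fourier_has_integral:
  assumes S: "S > 0"
  shows "((\<lambda>t. complex_of_real (tent S t) * exp (\<i> * complex_of_real (u * t)))
           has_integral complex_of_real (fejer S u)) {-S..S}"
proof -
  let ?f = "\<lambda>t. complex_of_real (tent S t) * exp (\<i> * complex_of_real (u * t))"
  show ?thesis
  proof (cases "u = 0")
    case True
    have "((\<lambda>t. 1 + t / S) has_integral ((0 + 0\<^sup>2 / (2*S)) - (-S + (-S)\<^sup>2 / (2*S)))) {-S..0}"
      using S by (intro fundamental_theorem_of_calculus)
         (auto simp flip: has_real_derivative_iff_has_vector_derivative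
          intro!: derivative_eq_intros simp: field_simps)
    hence "((\<lambda>t. complex_of_real (1 + t / S)) has_integral complex_of_real (S/2)) {-S..0}"
      using S by (intro has_integral_of_real) (simp add: field_simps power2_eq_square)
    hence 1: "(?f has_integral (complex_of_real (S/2))) {-S..0}"
      using S True
      by (subst has_integral_cong[where g="\<lambda>t. complex_of_real (1 + t / S)"])
         (auto simp: tent_def field_simps max_def)
    have "((\<lambda>t. 1 - t / S) has_integral ((S - S\<^sup>2 / (2*S)) - (0 - 0\<^sup>2 / (2*S)))) {0..S}"
      using S by (intro fundamental_theorem_of_calculus)
         (auto simp flip: has_real_derivative_iff_has_vector_derivative
          intro!: derivative_eq_intros simp: field_simps)
    hence "((\<lambda>t. complex_of_real (1 - t / S)) has_integral complex_of_real (S/2)) {0..S}"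
      using S by (intro has_integral_of_real) (simp add: field_simps power2_eq_square)
    hence 2: "(?f has_integral (complex_of_real (S/2))) {0..S}"
      using S True
      by (subst has_integral_cong[where g="\<lambda>t. complex_of_real (1 - t / S)"])
         (auto simp: tent_def field_simps max_def)
    have "(?f has_integral (complex_of_real (S/2) + complex_of_real (S/2))) {-S..S}"
      by (rule has_integral_combine[OF _ _ 1 2]) (use S in auto)
    thus ?thesis using True by (simp add: fejer_def)
  next
    case False
    \<comment> \<open>\<open>?G s\<close> is an antiderivative obtained by parts; \<open>s = 1\<close> and \<open>s = -1\<close> serve the rising and the falling edge of the tent.\<close>
    let ?e = "\<lambda>t. exp (\<i> * complex_of_real u * complex_of_real t)"
    let ?G = "\<lambda>s t. (1 + complex_of_real (s * t / S)) * ?e t / (\<i> * u)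
       - complex_of_real (s / S) * ?e t / (\<i> * u)\<^sup>2"
    have G: "(?G s has_vector_derivative (1 + complex_of_real (s * t / S)) * ?e t) (at t within A)"
      for s t :: real and A
    proof -
      have e: "(?e has_vector_derivative \<i> * complex_of_real u * ?e t) (at t within A)"
        by (rule has_vector_derivative_real_field)
           (auto intro!: derivative_eq_intros simp: algebra_simps)
      have l: "((\<lambda>t. 1 + complex_of_real (s * t / S)) has_vector_derivative complex_of_real (s / S)) (at t within A)"
        using S by (auto simp: has_real_derivative_iff_has_vector_derivative[symmetric] 
          intro!: derivative_eq_intros has_vector_derivative_of_real)
      show ?thesis
        by (rule derivative_eq_intros e l refl)+
           (use False S in \<open>simp add: field_simps power2_eq_square\<close>)
    qed
    have "((\<lambda>t. (1 + complex_of_real (1 * t / S)) * ?e t) has_integral (?G 1 0 - ?G 1 (-S))) {-S..0}"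
      using S G[of 1] by (intro fundamental_theorem_of_calculus) auto
    hence 1: "(?f has_integral (?G 1 0 - ?G 1 (-S))) {-S..0}"
      using S
      by (subst has_integral_cong[where g="\<lambda>t. (1 + complex_of_real (1 * t / S)) * ?e t"])
         (auto simp: tent_def field_simps max_def mult_ac)
    have "((\<lambda>t. (1 + complex_of_real (- 1 * t / S)) * ?e t) has_integral (?G (-1) S - ?G (-1) 0)) {0..S}"
      using S G[of "-1"] by (intro fundamental_theorem_of_calculus) auto
    hence 2: "(?f has_integral (?G (-1) S - ?G (-1) 0)) {0..S}"
      using S
      by (subst has_integral_cong[where g="\<lambda>t. (1 + complex_of_real (- 1 * t / S)) * ?e t"])
         (auto simp: tent_def field_simps max_def mult_ac)
    have "(?f has_integral ((?G 1 0 - ?G 1 (-S)) + (?G (-1) S - ?G (-1) 0))) {-S..S}"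
      by (rule has_integral_combine[OF _ _ 1 2]) (use S in auto)
    also have "(?G 1 0 - ?G 1 (-S)) + (?G (-1) S - ?G (-1) 0) = fejer S u"
    proof -
      have c: "exp (\<i> * complex_of_real u * complex_of_real S) = cis (S * u)"
        "exp (\<i> * complex_of_real u * complex_of_real (-S)) = cis (-(S * u))"
        by (simp_all add: cis_conv_exp mult_ac)
      have z: "1 + complex_of_real (1 * - S / S) = 0" "1 + complex_of_real (- 1 * S / S) = 0"
        using S by simp_all
      have "(?G 1 0 - ?G 1 (-S)) + (?G (-1) S - ?G (-1) 0)
          = (2 - (cis (S * u) + cis (-(S * u)))) / complex_of_real (S * u\<^sup>2)"
        unfolding c z by (simp add: power_mult_distrib diff_divide_distrib add_divide_distrib)
      also have "cis (S * u) + cis (-(S * u)) = complex_of_real (2 * cos (S * u))"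
        by (simp add: complex_eq_iff)
      finally show ?thesis
        using False by (simp add: fejer_def)
    qed
    finally show ?thesis .
  qed
qed

lemma tent_char_integrable:
  assumes S: "S > 0"
  shows "integrable lborel (\<lambda>t. complex_of_real (tent S t) * exp (\<i> * complex_of_real (u * t)))"
proof -
  let ?f = "\<lambda>t. complex_of_real (tent S t) * exp (\<i> * complex_of_real (u * t))"
  have "set_integrable lborel {-S..S} ?f"
    using continuous_tent by (intro borel_integrable_atLeastAtMost' continuous_intros) auto
  thus ?thesis
    unfolding set_integrable_def
    by (rule Bochner_Integration.integrable_cong[THEN iffD1, rotated -1])
       (use S in \<open>auto simp: indicator_def tent_eq_0\<close>)
qed

lemma fourier_tent:
  assumes S: "S > 0"
  shows "(\<integral>t. complex_of_real (tent S t) * exp (\<i> * complex_of_real (u * t)) \<partial>lborel) = fejer S u"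
proof -
  let ?f = "\<lambda>t. complex_of_real (tent S t) * exp (\<i> * complex_of_real (u * t))"
  have "(?f has_integral fejer S u) UNIV"
    using tent_fourier_has_integral[OF S, of u] 
    by (rule has_integral_on_superset) (use S in \<open>auto intro!: tent_eq_0\<close>)
  with has_integral_integral_lborel[OF tent_char_integrable[OF S, of u]]
  show ?thesis by (rule has_integral_unique)
qed

lemma one_minus_cos: "1 - cos x = 2 * (sin (x/2))\<^sup>2" for x :: real
  using cos_double_sin[of "x/2"] by simp

lemma fejer_nonneg: "S > 0 \<Longrightarrow> 0 \<le> fejer S u"
  by (auto simp: fejer_def)

text \<open>
  Combines the estimates \<open>1 - cos x \<le> x\<^sup>2 / 2\<close> (good near the origin) and
  \<open>1 - cos x \<le> 2\<close> (good far away) in one bound without case distinction.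
\<close>

lemma fejer_le:
  assumes "S > 0"
  shows "fejer S u \<le> 8 * S / (1 + (S * u)\<^sup>2)"
proof (cases "u = 0")
  case False
  have p: "0 < (S*u)\<^sup>2" using False assms by simp
  have near_0: "1 - cos (S*u) \<le> (S*u)\<^sup>2 / 2"
  proof -
    have "(sin (S*u/2))\<^sup>2 \<le> (S*u/2)\<^sup>2"
      using abs_sin_x_le_abs_x[of "S*u/2"] by (simp only: abs_le_square_iff)
    thus ?thesis unfolding one_minus_cos by (simp add: power_divide)
  qed
  have "1 - cos (S*u) \<le> 2" using cos_ge_minus_one[of "S*u"] by linarith
  hence "(1 - cos (S*u)) * (S*u)\<^sup>2 \<le> 2 * (S*u)\<^sup>2"
    using p by (intro mult_right_mono) auto
  hence le: "(1 - cos (S*u)) * (1 + (S*u)\<^sup>2) \<le> 4 * (S*u)\<^sup>2"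
    using near_0 p unfolding distrib_left mult_1_right by linarith
  have "(1 - cos (S*u)) / (S*u)\<^sup>2 \<le> 4 / (1 + (S*u)\<^sup>2)"
    by (rule mult_imp_le_div_pos, use p in linarith,
        unfold times_divide_eq_left, rule mult_imp_div_pos_le[OF p le])
  hence "2 * S * ((1 - cos (S*u)) / (S*u)\<^sup>2) \<le> 2 * S * (4 / (1 + (S*u)\<^sup>2))"
    using assms by (intro mult_left_mono) auto
  hence "2 * S * (1 - cos (S*u)) / (S*u)\<^sup>2 \<le> 8 * S / (1 + (S * u)\<^sup>2)"
    by simp
  also have "2 * S * (1 - cos (S*u)) / (S*u)\<^sup>2 = fejer S u"
    using False assms by (simp add: fejer_def field_simps power2_eq_square)
  finally show ?thesis .
qed (use assms in \<open>simp add: fejer_def\<close>)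

lemma fejer_ge:
  assumes "S > 0" and "\<bar>S * u\<bar> \<le> 1"
  shows "S / 2 \<le> fejer S u"
proof (cases "u = 0")
  case False
  have "cos x \<le> 1 - x\<^sup>2 / 4" if "\<bar>x\<bar> \<le> 1" for x :: real
  proof -
    obtain t where "cos x = (\<Sum>m<4. cos_coeff m * x ^ m) + (cos (t + 1/2 * real 4 * pi) / fact 4) * x ^ 4"
      using Maclaurin_cos_expansion[of x 4] by blast
    also have "(\<Sum>m<4. cos_coeff m * x ^ m) = 1 - x\<^sup>2 / 2"
    proof -
      have "{..<4::nat} = {0, 1, 2, 3}" by auto
      thus ?thesis by (simp add: cos_coeff_def)
    qed
    also have "(cos (t + 1/2 * real 4 * pi) / fact 4) * x ^ 4 \<le> x ^ 4 / 24"
      using mult_right_mono[OF cos_le_one[of "t + 1/2 * real 4 * pi"], of "x ^ 4 / 24"]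
      by (simp add: fact_numeral)
    also have "x ^ 4 \<le> x\<^sup>2"
      using that power_decreasing[of 2 4 "\<bar>x\<bar>"] by simp
    finally have "cos x \<le> 1 - x\<^sup>2 / 2 + x\<^sup>2 / 24" by simp
    thus ?thesis using zero_le_power2[of x] by linarith
  qed
  from this[OF assms(2)] have "(S*u)\<^sup>2 / 4 \<le> 1 - cos (S*u)" by simp
  hence "S / 2 * (S * u\<^sup>2) \<le> 2 * (1 - cos (S*u))"
    by (simp add: power2_eq_square mult_ac)
  thus ?thesis using False assms(1)
    by (simp add: fejer_def pos_le_divide_eq)
qed (use assms in \<open>simp add: fejer_def\<close>)

section \<open>Product kernels and the energy identity\<close>

lemma
  fixes f :: "'a::euclidean_space \<Rightarrow> real \<Rightarrow> complex"
  assumes int: "\<And>b. b \<in> Basis \<Longrightarrow> integrable lborel (f b)"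
  shows integral_lborel_prod: "(\<integral>z. (\<Prod>b\<in>Basis. f b (z \<bullet> b)) \<partial>lborel) = (\<Prod>b\<in>Basis. \<integral>t. f b t \<partial>lborel)"
    and integrable_lborel_prod: "integrable lborel (\<lambda>z. \<Prod>b\<in>Basis. f b (z \<bullet> b))"
proof -
  interpret product_sigma_finite "\<lambda>_::'a. lborel :: real measure" ..
  have f [measurable]: "f b \<in> borel_measurable borel" if "b \<in> Basis" for b
    using borel_measurable_integrable[OF int[OF that]] by simp
  have m: "(\<lambda>z. \<Prod>b\<in>Basis. f b (z \<bullet> b)) \<in> borel_measurable borel" by measurable
  have e: "(\<Prod>b\<in>Basis. f b ((\<Sum>b\<in>Basis. x b *\<^sub>R b) \<bullet> b)) = (\<Prod>b\<in>Basis. f b (x b))" for x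
    by (intro prod.cong refl) simp
  have d: "(\<lambda>x. \<Sum>b\<in>Basis. x b *\<^sub>R b) \<in> (\<Pi>\<^sub>M b\<in>Basis. lborel) \<rightarrow>\<^sub>M (borel :: 'a measure)"
    by measurable
  show "(\<integral>z. (\<Prod>b\<in>Basis. f b (z \<bullet> b)) \<partial>lborel) = (\<Prod>b\<in>Basis. \<integral>t. f b t \<partial>lborel)"
    unfolding lborel_eq[where 'a='a] integral_distr[OF d m] e
    by (rule product_integral_prod) (auto intro: int)
  show "integrable lborel (\<lambda>z. \<Prod>b\<in>Basis. f b (z \<bullet> b))"
    unfolding lborel_eq[where 'a='a] integrable_distr_eq[OF d m] e
    by (rule product_integrable_prod) (auto intro: int)
qed

definition tent_prod :: "real \<Rightarrow> 'a::euclidean_space \<Rightarrow> real" where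
  "tent_prod S z = (\<Prod>b\<in>Basis. tent S (z \<bullet> b))"

definition fejer_prod :: "real \<Rightarrow> 'a::euclidean_space \<Rightarrow> real" where
  "fejer_prod S w = (\<Prod>b\<in>Basis. fejer S (w \<bullet> b))"

lemma exp_inner_prod:
  fixes w z :: "'a::euclidean_space"
  shows "exp (\<i> * complex_of_real (w \<bullet> z)) = (\<Prod>b\<in>Basis. exp (\<i> * complex_of_real ((w \<bullet> b) * (z \<bullet> b))))"
  by (subst euclidean_inner) (simp add: exp_sum sum_distrib_left)

lemma tent_prod_nonneg: "0 \<le> tent_prod S z"
  by (simp add: tent_prod_def prod_nonneg tent_nonneg)

lemma fejer_prod_nonneg: "S > 0 \<Longrightarrow> 0 \<le> fejer_prod S z"
  by (simp add: fejer_prod_def prod_nonneg fejer_nonneg)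

lemma tent_prod_measurable [measurable]: "tent_prod S \<in> borel_measurable borel"
  unfolding tent_prod_def by measurable

lemma fejer_measurable [measurable]: "fejer S \<in> borel_measurable borel"
  unfolding fejer_def by measurable

lemma fejer_prod_measurable [measurable]: "fejer_prod S \<in> borel_measurable borel"
  unfolding fejer_prod_def by measurable

lemma
  fixes w :: "'a::euclidean_space"
  assumes S: "S > 0"
  shows fourier_tent_prod:
      "(\<integral>z. complex_of_real (tent_prod S z) * exp (\<i> * complex_of_real (w \<bullet> z)) \<partial>lborel) = fejer_prod S w"
    and tent_prod_char_integrable:
      "integrable lborel (\<lambda>z. complex_of_real (tent_prod S z) * exp (\<i> * complex_of_real (w \<bullet> z)))"
proof -
  let ?f = "\<lambda>b t. complex_of_real (tent S t) * exp (\<i> * complex_of_real ((w \<bullet> b) * t))"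
  have i: "integrable lborel (?f b)" for b
    by (rule tent_char_integrable[OF S])
  have e: "complex_of_real (tent_prod S z) * exp (\<i> * complex_of_real (w \<bullet> z)) = (\<Prod>b\<in>Basis. ?f b (z \<bullet> b))" for z
    unfolding exp_inner_prod tent_prod_def by (simp add: prod.distrib)
  show "(\<integral>z. complex_of_real (tent_prod S z) * exp (\<i> * complex_of_real (w \<bullet> z)) \<partial>lborel) = fejer_prod S w"
    unfolding e integral_lborel_prod[OF i] fourier_tent[OF S] fejer_prod_def by simp
  show "integrable lborel (\<lambda>z. complex_of_real (tent_prod S z) * exp (\<i> * complex_of_real (w \<bullet> z)))"
    unfolding e by (rule integrable_lborel_prod[OF i])
qed

lemma tent_prod_integrable:
  assumes S: "S > 0"
  shows "integrable lborel (tent_prod S :: 'a::euclidean_space \<Rightarrow> real)"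
  using integrable_norm[OF tent_prod_char_integrable[OF S, of "0::'a"]]
  by (simp add: tent_prod_nonneg)

lemma fejer_le_const: "S > 0 \<Longrightarrow> fejer S u \<le> 8 * S"
  using fejer_le[of S u] by (rule order_trans) (auto simp: divide_simps add_pos_nonneg)

lemma fejer_prod_le:
  "S > 0 \<Longrightarrow> fejer_prod S (w::'a::euclidean_space) \<le> (8 * S) ^ DIM('a)"
  unfolding fejer_prod_def prod_constant[symmetric]
  by (intro prod_mono conjI fejer_nonneg fejer_le_const)

lemma fejer_prod_integrable:
  fixes \<mu> :: "'a::euclidean_space measure"
  assumes "prob_space \<mu>" and sets: "sets \<mu> = sets borel" and S: "S > 0"
  shows "integrable (\<mu> \<Otimes>\<^sub>M \<mu>) (\<lambda>p. fejer_prod S (fst p - snd p))"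
proof -
  note [measurable_cong] = sets
  interpret prob_space \<mu> by fact
  interpret P: pair_prob_space \<mu> \<mu> ..
  show ?thesis
    by (rule P.P.integrable_const_bound[where B="(8 * S) ^ DIM('a)"])
       (use fejer_prod_le[OF S, where 'a='a] in \<open>auto simp: fejer_prod_nonneg S\<close>)
qed

lemma fourier_measure_measurable:
  assumes "sigma_finite_measure \<mu>" and sets: "sets \<mu> = sets borel"
  shows "fourier_measure \<mu> \<in> borel_measurable borel"
proof -
  note [measurable_cong] = sets
  interpret sigma_finite_measure \<mu> by fact
  show ?thesis unfolding fourier_measure_def by measurable
qed

lemma norm_fourier_measure_le:
  assumes "prob_space \<mu>"
  shows "cmod (fourier_measure \<mu> z) \<le> 1"
proof -
  interpret prob_space \<mu> by fact
  have "cmod (fourier_measure \<mu> z) \<le> (\<integral>x. cmod (exp (\<i> * complex_of_real (x \<bullet> z))) \<partial>\<mu>)"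
    unfolding fourier_measure_def by (rule integral_norm_bound)
  also have "\<dots> = 1" by (simp add: prob_space)
  finally show ?thesis .
qed

text \<open>
  The squared modulus of the transform of \<open>\<mu>\<close> is the transform of the law of the difference
  of two independent \<open>\<mu>\<close>-distributed points.
\<close>

lemma cmod_fourier_measure_squared:
  assumes "prob_space \<mu>" and sets: "sets \<mu> = sets borel"
  shows "complex_of_real ((cmod (fourier_measure \<mu> z))\<^sup>2)
       = (\<integral>p. exp (\<i> * complex_of_real ((fst p - snd p) \<bullet> z)) \<partial>(\<mu> \<Otimes>\<^sub>M \<mu>))"
proof -
  note [measurable_cong] = sets
  interpret prob_space \<mu> by fact
  interpret P: pair_prob_space \<mu> \<mu> ..
  let ?e = "\<lambda>x. exp (\<i> * complex_of_real (x \<bullet> z))"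
  have i: "integrable (\<mu> \<Otimes>\<^sub>M \<mu>) (\<lambda>p. exp (\<i> * complex_of_real ((fst p - snd p) \<bullet> z)))"
    by (rule P.P.integrable_const_bound[where B=1]) auto
  have "complex_of_real ((cmod (fourier_measure \<mu> z))\<^sup>2) = fourier_measure \<mu> z * cnj (fourier_measure \<mu> z)"
    by (simp only: complex_norm_square)
  also have "cnj (fourier_measure \<mu> z) = (\<integral>y. cnj (?e y) \<partial>\<mu>)"
    unfolding fourier_measure_def by simp
  also have "fourier_measure \<mu> z * (\<integral>y. cnj (?e y) \<partial>\<mu>) = (\<integral>x. (\<integral>y. ?e x * cnj (?e y) \<partial>\<mu>) \<partial>\<mu>)"
    unfolding fourier_measure_def by simp
  also have "\<dots> = (\<integral>x. (\<integral>y. exp (\<i> * complex_of_real ((fst (x, y) - snd (x, y)) \<bullet> z)) \<partial>\<mu>) \<partial>\<mu>)"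
    by (simp add: exp_cnj inner_diff_left exp_diff exp_minus divide_inverse ring_distribs exp_add)
  also have "\<dots> = (\<integral>p. exp (\<i> * complex_of_real ((fst p - snd p) \<bullet> z)) \<partial>(\<mu> \<Otimes>\<^sub>M \<mu>))"
    by (rule P.integral_fst'[OF i])
  finally show ?thesis .
qed

lemma tent_energy_integrable:
  assumes "prob_space \<mu>" and sets: "sets \<mu> = sets borel" and S: "S > 0"
  shows "integrable lborel (\<lambda>z. tent_prod S z * (cmod (fourier_measure \<mu> z))\<^sup>2)"
proof (rule Bochner_Integration.integrable_bound[OF tent_prod_integrable[OF S]])
  interpret prob_space \<mu> by fact
  have [measurable]: "fourier_measure \<mu> \<in> borel_measurable borel"
    by (intro fourier_measure_measurable sets sigma_finite_measure_axioms)
  show "(\<lambda>z. tent_prod S z * (cmod (fourier_measure \<mu> z))\<^sup>2) \<in> borel_measurable lborel"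
    by measurable
  show "AE z in lborel. norm (tent_prod S z * (cmod (fourier_measure \<mu> z))\<^sup>2) \<le> norm (tent_prod S z)"
    using norm_fourier_measure_le[OF assms(1)]
    by (auto simp: abs_mult tent_prod_nonneg power_le_one intro!: mult_left_le)
qed

text \<open>
  Parseval's formula for the weight \<open>tent_prod S\<close>. It turns estimates of the energy on the
  Fourier side into estimates of a double integral of a nonnegative kernel over \<open>E\<close>.
\<close>

lemma tent_energy:
  assumes "prob_space \<mu>" and sets: "sets \<mu> = sets borel" and S: "S > 0"
  shows "(\<integral>z. tent_prod S z * (cmod (fourier_measure \<mu> z))\<^sup>2 \<partial>lborel)
       = (\<integral>p. fejer_prod S (fst p - snd p) \<partial>(\<mu> \<Otimes>\<^sub>M \<mu>))"
proof -
  note [measurable_cong] = sets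
  interpret prob_space \<mu> by fact
  interpret P: pair_prob_space \<mu> \<mu> ..
  interpret Q: pair_sigma_finite lborel "\<mu> \<Otimes>\<^sub>M \<mu>" ..
  let ?h = "\<lambda>z p. complex_of_real (tent_prod S z) * exp (\<i> * complex_of_real ((fst p - snd p) \<bullet> z))"
  have h: "integrable (lborel \<Otimes>\<^sub>M (\<mu> \<Otimes>\<^sub>M \<mu>)) (case_prod ?h)"
  proof (rule Q.Fubini_integrable)
    show "case_prod ?h \<in> borel_measurable (lborel \<Otimes>\<^sub>M (\<mu> \<Otimes>\<^sub>M \<mu>))"
      by measurable
    show "integrable lborel (\<lambda>z. \<integral>p. norm (case_prod ?h (z, p)) \<partial>(\<mu> \<Otimes>\<^sub>M \<mu>))"
      using tent_prod_integrable[OF S] by (simp add: norm_mult tent_prod_nonneg P.P.prob_space)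
    show "AE z in lborel. integrable (\<mu> \<Otimes>\<^sub>M \<mu>) (\<lambda>p. case_prod ?h (z, p))"
      by (intro AE_I2 P.P.integrable_const_bound[where B="tent_prod S _"])
         (auto simp: norm_mult tent_prod_nonneg)
  qed
  have "complex_of_real (\<integral>z. tent_prod S z * (cmod (fourier_measure \<mu> z))\<^sup>2 \<partial>lborel)
      = (\<integral>z. (\<integral>p. ?h z p \<partial>(\<mu> \<Otimes>\<^sub>M \<mu>)) \<partial>lborel)"
    by (simp flip: integral_complex_of_real add: cmod_fourier_measure_squared[OF assms(1,2)] del: of_real_power)
  also have "\<dots> = (\<integral>p. (\<integral>z. ?h z p \<partial>lborel) \<partial>(\<mu> \<Otimes>\<^sub>M \<mu>))"
    by (rule Q.Fubini_integral[OF h, symmetric])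
  also have "\<dots> = (\<integral>p. complex_of_real (fejer_prod S (fst p - snd p)) \<partial>(\<mu> \<Otimes>\<^sub>M \<mu>))"
    by (simp add: fourier_tent_prod[OF S])
  also have "\<dots> = complex_of_real (\<integral>p. fejer_prod S (fst p - snd p) \<partial>(\<mu> \<Otimes>\<^sub>M \<mu>))"
    by simp
  finally show ?thesis by (simp only: of_real_eq_iff)
qed

section \<open>Lower bound from a cover\<close>

text \<open>
  Collisions are least likely when the cells have equal mass. After making the cells
  disjoint, the collision probability is the sum of the squares of numbers with sum 1, so
  that Cauchy-Schwarz applies.
\<close>

lemma prob_same_cell_ge:
  fixes A :: "nat \<Rightarrow> 'a set"
  assumes "prob_space \<mu>" and n: "n > 0"
    and A: "\<And>i. A i \<in> sets \<mu>" and cover: "AE x in \<mu>. x \<in> (\<Union>i<n. A i)"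
  shows "1 / n \<le> measure (\<mu> \<Otimes>\<^sub>M \<mu>) (\<Union>i<n. A i \<times> A i)"
proof -
  interpret prob_space \<mu> by fact
  interpret P: pair_prob_space \<mu> \<mu> ..
  define V where "V = disjointed A"
  have V [measurable]: "V i \<in> sets \<mu>" for i
    unfolding V_def using A by (intro sets.range_disjointed_sets[THEN subsetD, OF _ rangeI]) auto
  have disj: "disjoint_family V" unfolding V_def by (rule disjoint_family_disjointed)
  have UN: "(\<Union>i<n. V i) = (\<Union>i<n. A i)"
    unfolding V_def lessThan_atLeast0 by (rule finite_UN_disjointed_eq)
  have "(\<Sum>i<n. prob (V i)) = prob (\<Union>i<n. V i)"
    using disj by (intro finite_measure_finite_Union[symmetric])
       (auto simp: disjoint_family_on_def)
  also have "\<dots> = 1"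
    unfolding UN using A cover by (intro prob_eq_1[THEN iffD2]) auto
  finally have one: "(\<Sum>i<n. prob (V i)) = 1" .
  have "1 = (\<Sum>i<n. prob (V i) * 1)\<^sup>2" using one by simp
  also have "\<dots> \<le> (\<Sum>i<n. (prob (V i))\<^sup>2) * (\<Sum>i<n. 1\<^sup>2)"
    by (rule Cauchy_Schwarz_ineq_sum)
  finally have "1 / n \<le> (\<Sum>i<n. (prob (V i))\<^sup>2)"
    using n by (simp add: field_simps)
  also have "\<dots> = (\<Sum>i<n. measure (\<mu> \<Otimes>\<^sub>M \<mu>) (V i \<times> V i))"
    by (simp add: measure_def emeasure_pair_measure_Times enn2real_mult power2_eq_square)
  also have "\<dots> = measure (\<mu> \<Otimes>\<^sub>M \<mu>) (\<Union>i<n. V i \<times> V i)"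
    using disj by (intro P.P.finite_measure_finite_Union[symmetric])
       (auto simp: disjoint_family_on_def)
  also have "\<dots> \<le> measure (\<mu> \<Otimes>\<^sub>M \<mu>) (\<Union>i<n. A i \<times> A i)"
    using A unfolding V_def
    by (intro P.P.finite_measure_mono UN_mono Sigma_mono disjointed_subset) auto
  finally show ?thesis .
qed

lemma fejer_prod_ge:
  fixes w :: "'a::euclidean_space"
  assumes S: "S > 0" and w: "S * norm w \<le> 1"
  shows "(S / 2) ^ DIM('a) \<le> fejer_prod S w"
  unfolding fejer_prod_def prod_constant[symmetric]
proof (intro prod_mono conjI fejer_ge S)
  fix b :: 'a assume "b \<in> Basis"
  then have "S * \<bar>w \<bullet> b\<bar> \<le> S * norm w"
    using S by (intro mult_left_mono Basis_le_norm) auto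
  hence "S * \<bar>w \<bullet> b\<bar> \<le> 1" using w by linarith
  thus "\<bar>S * (w \<bullet> b)\<bar> \<le> 1" using S by (simp add: abs_mult)
qed (use S in auto)

text \<open>
  The cube with half side \<open>R / d\<close>, which supports the product kernel, lies in the ball of
  radius \<open>R\<close> because the Euclidean norm is at most the sum of the coordinates.
\<close>

lemma tent_prod_le_indicator:
  fixes z :: "'a::euclidean_space"
  assumes R: "R > 0"
  shows "tent_prod (R / DIM('a)) z \<le> indicator (cball 0 R) z"
proof (cases "\<exists>b\<in>Basis. R / DIM('a) \<le> \<bar>z \<bullet> b\<bar>")
  case True
  then have "tent_prod (R / DIM('a)) z = 0"
    using R by (auto simp: tent_prod_def intro!: tent_eq_0)
  thus ?thesis by simp
next
  case False
  have "norm z \<le> (\<Sum>b\<in>Basis. \<bar>z \<bullet> b\<bar>)" by (rule norm_le_l1)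
  also have "\<dots> \<le> (\<Sum>b\<in>(Basis::'a set). R / DIM('a))" using False by (intro sum_mono) force
  also have "\<dots> = R" by simp
  finally have "z \<in> cball 0 R" by simp
  moreover have "tent_prod (R / DIM('a)) z \<le> 1"
    unfolding tent_prod_def using R by (intro prod_le_1 conjI tent_nonneg tent_le_one) auto
  ultimately show ?thesis by simp
qed

text \<open>
  On the ball of radius \<open>R\<close> each coordinate is at most half of the half-width \<open>2 R\<close> of the tent,
  where the tent is still at least \<open>1/2\<close>.
\<close>

lemma indicator_le_tent_prod:
  fixes z :: "'a::euclidean_space"
  assumes R: "R > 0"
  shows "indicator (cball 0 R) z \<le> 2 ^ DIM('a) * tent_prod (2 * R) z"
proof (cases "z \<in> cball 0 R")
  case True
  have "1 / 2 \<le> tent (2 * R) (z \<bullet> b)" if "b \<in> Basis" for b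
    using Basis_le_norm[OF that, of z] True R by (simp add: tent_def field_simps)
  hence "(\<Prod>b\<in>(Basis::'a set). 1 / 2) \<le> tent_prod (2 * R) z"
    unfolding tent_prod_def by (intro prod_mono) auto
  thus ?thesis using True by (simp add: field_simps)
qed (simp add: tent_prod_nonneg)

abbreviation ball_energy :: "(real ^ 'n) measure \<Rightarrow> real \<Rightarrow> real" where
  "ball_energy \<mu> R \<equiv> (LINT z:cball 0 R|lborel. (cmod (fourier_measure \<mu> z))\<^sup>2)"

lemma ball_energy_integrable:
  assumes "prob_space \<mu>" and sets: "sets \<mu> = sets borel"
  shows "set_integrable lborel (cball 0 R) (\<lambda>z. (cmod (fourier_measure \<mu> z))\<^sup>2)"
proof -
  interpret prob_space \<mu> by fact
  have [measurable]: "fourier_measure \<mu> \<in> borel_measurable borel"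
    by (intro fourier_measure_measurable sets sigma_finite_measure_axioms)
  show ?thesis unfolding set_integrable_def
    by (rule integrableI_bounded_set_indicator[where B=1])
       (use norm_fourier_measure_le[OF assms(1)] emeasure_lborel_cball_finite in \<open>auto simp: power_le_one\<close>)
qed

lemma ball_energy_ge:
  fixes \<mu> :: "(real ^ 'n) measure"
  assumes "prob_space \<mu>" and sets: "sets \<mu> = sets borel" and R: "R > 0"
    and fin: "finite \<U>" and \<U>: "\<And>U. U \<in> \<U> \<Longrightarrow> bounded U \<and> diameter U \<le> 1 / R"
    and cover: "AE x in \<mu>. x \<in> \<Union>\<U>"
  shows "(R / (2 * CARD('n))) ^ CARD('n) / card \<U> \<le> ball_energy \<mu> R"
proof -
  note [measurable_cong] = sets
  interpret prob_space \<mu> by fact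
  interpret P: pair_prob_space \<mu> \<mu> ..
  define S where "S = R / CARD('n)"
  have S: "S > 0" using R by (simp add: S_def)
  have "\<U> \<noteq> {}" using cover AE_False by auto
  hence n: "card \<U> > 0" using fin by (simp add: card_gt_0_iff)
  obtain g where g: "bij_betw g {..<card \<U>} \<U>"
    using ex_bij_betw_nat_finite[OF fin] by (auto simp: lessThan_atLeast0)
  \<comment> \<open>Covering sets may fail to be Borel; their closures are Borel and have the same diameter.\<close>
  define A where "A i = closure (g i)" for i
  have gi: "g i \<in> \<U>" if "i < card \<U>" for i using g that by (auto simp: bij_betw_def)
  let ?D = "\<Union>i<card \<U>. A i \<times> A i"
  have A [measurable]: "A i \<in> sets \<mu>" for i using sets by (simp add: A_def)
  have D: "(S / 2) ^ CARD('n) \<le> fejer_prod S (fst p - snd p)" if "p \<in> ?D" for p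
  proof -
    from that obtain i where i: "i < card \<U>" "fst p \<in> closure (g i)" "snd p \<in> closure (g i)"
      by (auto simp: A_def mem_Times_iff)
    have "dist (fst p) (snd p) \<le> diameter (closure (g i))"
      using i \<U>[OF gi[OF i(1)]] by (intro diameter_bounded_bound bounded_closure) auto
    also have "\<dots> \<le> 1 / R" using \<U>[OF gi[OF i(1)]] by (simp add: diameter_closure)
    finally have "R * norm (fst p - snd p) \<le> 1" using R by (simp add: dist_norm field_simps)
    moreover have "S * norm (fst p - snd p) \<le> R * norm (fst p - snd p)"
      using R by (intro mult_right_mono) (auto simp: S_def field_simps)
    ultimately show ?thesis using fejer_prod_ge[OF S, of "fst p - snd p"] by simp
  qed
  have cov: "AE x in \<mu>. x \<in> (\<Union>i<card \<U>. A i)"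
    using cover
  proof eventually_elim
    case (elim x)
    then obtain U where U: "U \<in> \<U>" "x \<in> U" by auto
    then have "U \<in> g ` {..<card \<U>}" using g by (simp add: bij_betw_def)
    then obtain i where "i < card \<U>" "g i = U" by auto
    thus ?case using U closure_subset[of U] by (auto simp: A_def)
  qed
  have "(S / 2) ^ CARD('n) * (1 / card \<U>) \<le> (S / 2) ^ CARD('n) * measure (\<mu> \<Otimes>\<^sub>M \<mu>) ?D"
    using prob_same_cell_ge[OF assms(1) n A cov] S by (intro mult_left_mono) auto
  also have "\<dots> = (\<integral>p. (S / 2) ^ CARD('n) * indicator ?D p \<partial>(\<mu> \<Otimes>\<^sub>M \<mu>))"
    by simp
  also have "\<dots> \<le> (\<integral>p. fejer_prod S (fst p - snd p) \<partial>(\<mu> \<Otimes>\<^sub>M \<mu>))"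
  proof (rule integral_mono)
    show "integrable (\<mu> \<Otimes>\<^sub>M \<mu>) (\<lambda>p. (S / 2) ^ CARD('n) * indicator ?D p)"
      by (intro integrable_mult_right P.P.integrable_const_bound[where B=1]) auto
    show "(S / 2) ^ CARD('n) * indicator ?D p \<le> fejer_prod S (fst p - snd p)" for p
      using D[of p] S by (cases "p \<in> ?D") (auto simp: fejer_prod_nonneg)
  qed (intro fejer_prod_integrable assms S)
  also have "\<dots> = (\<integral>z. tent_prod S z * (cmod (fourier_measure \<mu> z))\<^sup>2 \<partial>lborel)"
    by (rule tent_energy[symmetric]) fact+
  also have "\<dots> \<le> ball_energy \<mu> R"
    unfolding set_lebesgue_integral_def
    using ball_energy_integrable[OF assms(1,2), of R] tent_prod_le_indicator[OF R, where 'a="real^'n"]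
    by (intro integral_mono tent_energy_integrable assms S)
       (auto simp: set_integrable_def S_def intro!: mult_right_mono)
  finally show ?thesis by (simp add: S_def mult.commute)
qed

lemma ball_energy_le:
  fixes \<mu> :: "(real ^ 'n) measure"
  assumes "prob_space \<mu>" and sets: "sets \<mu> = sets borel" and R: "R > 0"
  shows "ball_energy \<mu> R \<le> 2 ^ CARD('n) * (\<integral>p. fejer_prod (2 * R) (fst p - snd p) \<partial>(\<mu> \<Otimes>\<^sub>M \<mu>))"
proof -
  have R2: "2 * R > 0" using R by simp
  have "ball_energy \<mu> R \<le> (\<integral>z. 2 ^ CARD('n) * (tent_prod (2 * R) z * (cmod (fourier_measure \<mu> z))\<^sup>2) \<partial>lborel)"
    unfolding set_lebesgue_integral_def
    using ball_energy_integrable[OF assms(1,2), of R] indicator_le_tent_prod[OF R, where 'a="real^'n"]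
    by (intro integral_mono integrable_mult_right tent_energy_integrable assms R2)
       (auto simp: set_integrable_def mult.assoc[symmetric] intro!: mult_right_mono)
  also have "\<dots> = 2 ^ CARD('n) * (\<integral>p. fejer_prod (2 * R) (fst p - snd p) \<partial>(\<mu> \<Otimes>\<^sub>M \<mu>))"
    using tent_energy[OF assms(1,2) R2] by simp
  finally show ?thesis .
qed

section \<open>Fejer sums over separated sets\<close>

lemma sum_int_inverse_square_bounded:
  "\<exists>B>0. \<forall>I::int set. finite I \<longrightarrow> (\<Sum>i\<in>I. 1 / (1 + (real_of_int i)\<^sup>2)) \<le> B"
proof -
  let ?f = "\<lambda>n. 1 / (1 + (real n)\<^sup>2)"
  have f: "summable ?f"
  proof (rule summable_comparison_test')
    show "summable (\<lambda>n. inverse (real n ^ 2))" by (rule inverse_power_summable) simp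
    show "norm (?f n) \<le> inverse (real n ^ 2)" if "n \<ge> 1" for n
      using that by (simp add: divide_simps add_pos_nonneg)
  qed
  have half: "(\<Sum>i\<in>I. 1 / (1 + (real_of_int i)\<^sup>2)) \<le> suminf ?f"
    if "finite I" "inj_on (\<lambda>i. nat \<bar>i\<bar>) I" for I
  proof -
    have "(\<Sum>i\<in>I. 1 / (1 + (real_of_int i)\<^sup>2)) = (\<Sum>n\<in>(\<lambda>i. nat \<bar>i\<bar>) ` I. ?f n)"
      using that by (simp add: sum.reindex)
    also have "\<dots> \<le> suminf ?f"
      using that f by (intro sum_le_suminf) auto
    finally show ?thesis .
  qed
  show ?thesis
  proof (intro exI[of _ "2 * suminf ?f"] conjI allI impI)
    show "0 < 2 * suminf ?f"
      using suminf_pos[OF f] by (simp add: add_pos_nonneg)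
    fix I :: "int set" assume I: "finite I"
    have "(\<Sum>i\<in>I. 1 / (1 + (real_of_int i)\<^sup>2))
        = (\<Sum>i\<in>I \<inter> {0..}. 1 / (1 + (real_of_int i)\<^sup>2)) + (\<Sum>i\<in>I - {0..}. 1 / (1 + (real_of_int i)\<^sup>2))"
      by (rule sum.Int_Diff[OF I])
    also have "\<dots> \<le> suminf ?f + suminf ?f"
      using I by (intro add_mono half) (auto simp: inj_on_def)
    finally show "(\<Sum>i\<in>I. 1 / (1 + (real_of_int i)\<^sup>2)) \<le> 2 * suminf ?f" by simp
  qed
qed

text \<open>
  Replaces the argument by the index of the grid cell of side \<open>1 / (d S)\<close> containing it, so
  that a sum over points can be compared with a sum over cells. Rounding down moves
  \<open>d S u\<close> by less than 1, which costs only a factor depending on \<open>d\<close>.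
\<close>

lemma fejer_le_floor:
  assumes S: "S > 0" and d: "d > 0"
  shows "fejer S u \<le> 24 * (real d)\<^sup>2 * S / (1 + (real_of_int \<lfloor>d * S * u\<rfloor>)\<^sup>2)"
proof -
  define m where "m = real_of_int \<lfloor>d * S * u\<rfloor>"
  define q where "q = (S * u)\<^sup>2"
  have d1: "(real d)\<^sup>2 \<ge> 1" using d by (simp add: one_le_power)
  have q: "q \<ge> 0" by (simp add: q_def)
  have "\<bar>m\<bar> \<le> \<bar>d * S * u\<bar> + 1" unfolding m_def by linarith
  hence "m\<^sup>2 \<le> (\<bar>d * S * u\<bar> + 1)\<^sup>2" by (simp add: abs_le_square_iff[symmetric])
  also have "\<dots> \<le> 2 * (d * S * u)\<^sup>2 + 2"
    using sum_squares_ge_zero[of "\<bar>d * S * u\<bar> - 1" 0] by (simp add: power2_eq_square algebra_simps)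
  also have "(d * S * u)\<^sup>2 = (real d)\<^sup>2 * q" by (simp add: q_def power_mult_distrib)
  finally have "1 + m\<^sup>2 \<le> 3 * (real d)\<^sup>2 * (1 + q)"
    using d1 mult_nonneg_nonneg[OF zero_le_power2[of "real d"] q] unfolding distrib_left by linarith
  hence "8 * S / (3 * (real d)\<^sup>2 * (1 + q)) \<le> 8 * S / (1 + m\<^sup>2)"
    using S by (intro divide_left_mono mult_pos_pos) (auto simp: add_pos_nonneg q d)
  hence "3 * (real d)\<^sup>2 * (8 * S / (3 * (real d)\<^sup>2 * (1 + q))) \<le> 3 * (real d)\<^sup>2 * (8 * S / (1 + m\<^sup>2))"
    by (intro mult_left_mono) auto
  also have "3 * (real d)\<^sup>2 * (8 * S / (3 * (real d)\<^sup>2 * (1 + q))) = 8 * S / (1 + q)"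
    using d q by (simp add: divide_simps)
  finally have "8 * S / (1 + q) \<le> 24 * (real d)\<^sup>2 * S / (1 + m\<^sup>2)" by (simp add: mult_ac)
  with fejer_le[OF S, of u] show ?thesis by (simp add: q_def m_def)
qed

text \<open>
  Grid cells of side \<open>1 / (d S)\<close> have diameter at most \<open>1 / S\<close>, the grid being half open, and
  so contain at most one point of \<open>F\<close>. The sum over \<open>F\<close> is then dominated by a sum over
  lattice points, which factors into one-dimensional sums of inverse squares.
\<close>

lemma sum_fejer_prod_le:
  "\<exists>C>0. \<forall>S>0. \<forall>F. \<forall>x::'a::euclidean_space. finite F \<longrightarrow>
     pairwise (\<lambda>y y'. 1 \<le> S * dist y y') F \<longrightarrow>
     (\<Sum>y\<in>F. fejer_prod S (x - y)) \<le> C * S ^ DIM('a)"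
proof -
  obtain B where B: "B > 0" "\<And>I::int set. finite I \<Longrightarrow> (\<Sum>i\<in>I. 1 / (1 + (real_of_int i)\<^sup>2)) \<le> B"
    using sum_int_inverse_square_bounded by blast
  let ?d = "DIM('a)"
  let ?C = "(24 * (real ?d)\<^sup>2 * B) ^ ?d"
  show ?thesis
  proof (intro exI[of _ ?C] conjI allI impI)
    show "0 < ?C" using B by simp
    fix S :: real and F :: "'a set" and x :: 'a
    assume S: "0 < S" and F: "finite F"
      and sep: "pairwise (\<lambda>y y'. 1 \<le> S * dist y y') F"
    define m where "m y = (\<lambda>b\<in>(Basis::'a set). \<lfloor>?d * S * ((x - y) \<bullet> b)\<rfloor>)" for y
    define h where "h i = 24 * (real ?d)\<^sup>2 * S / (1 + (real_of_int i)\<^sup>2)" for i :: int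
    define I where "I = (\<Union>y\<in>F. m y ` Basis)"
    have I: "finite I" using F by (auto simp: I_def)
    have h0: "0 \<le> h i" for i using S by (simp add: h_def)
    have inj: "inj_on m F"
    proof (rule inj_onI, rule ccontr)
      fix y y' assume y: "y \<in> F" "y' \<in> F" "m y = m y'" "y \<noteq> y'"
      have "\<bar>(y - y') \<bullet> b\<bar> < 1 / (?d * S)" if "b \<in> Basis" for b
      proof -
        have "\<lfloor>?d * S * ((x - y) \<bullet> b)\<rfloor> = \<lfloor>?d * S * ((x - y') \<bullet> b)\<rfloor>"
          using fun_cong[OF y(3), of b] that by (simp add: m_def)
        hence "\<bar>?d * S * ((x - y) \<bullet> b) - ?d * S * ((x - y') \<bullet> b)\<bar> < 1" by linarith
        also have "?d * S * ((x - y) \<bullet> b) - ?d * S * ((x - y') \<bullet> b) = - (?d * S * ((y - y') \<bullet> b))"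
          by (simp add: inner_diff_left algebra_simps)
        finally show ?thesis using S by (simp add: abs_mult field_simps)
      qed
      hence "(\<Sum>b\<in>Basis. \<bar>(y - y') \<bullet> b\<bar>) < (\<Sum>b\<in>(Basis::'a set). 1 / (?d * S))"
        by (intro sum_strict_mono) auto
      hence "dist y y' < 1 / S"
        using norm_le_l1[of "y - y'"] by (simp add: dist_norm)
      hence "S * dist y y' < 1" using S by (simp add: field_simps)
      thus False using pairwiseD[OF sep y(1,2,4)] by simp
    qed
    have "(\<Sum>y\<in>F. fejer_prod S (x - y)) \<le> (\<Sum>y\<in>F. \<Prod>b\<in>Basis. h (m y b))"
      unfolding fejer_prod_def h_def
      by (intro sum_mono prod_mono conjI fejer_nonneg S)
         (use fejer_le_floor[OF S, of ?d] in \<open>simp add: m_def\<close>)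
    also have "\<dots> = (\<Sum>g\<in>m ` F. \<Prod>b\<in>Basis. h (g b))"
      by (simp add: sum.reindex[OF inj])
    also have "\<dots> \<le> (\<Sum>g\<in>PiE (Basis::'a set) (\<lambda>_. I). \<Prod>b\<in>Basis. h (g b))"
    proof (rule sum_mono2)
      show "finite (PiE (Basis::'a set) (\<lambda>_. I))" by (intro finite_PiE I) auto
      show "m ` F \<subseteq> PiE Basis (\<lambda>_. I)" by (auto simp: I_def m_def)
    qed (intro prod_nonneg ballI h0)
    also have "\<dots> = (\<Prod>b\<in>(Basis::'a set). \<Sum>i\<in>I. h i)"
      by (rule prod_sum_PiE[symmetric]) (auto simp: I)
    also have "\<dots> = (\<Sum>i\<in>I. h i) ^ ?d" by simp
    also have "\<dots> \<le> (24 * (real ?d)\<^sup>2 * S * B) ^ ?d"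
    proof (rule power_mono)
      have "(\<Sum>i\<in>I. h i) = 24 * (real ?d)\<^sup>2 * S * (\<Sum>i\<in>I. 1 / (1 + (real_of_int i)\<^sup>2))"
        by (simp add: h_def sum_distrib_left)
      also have "\<dots> \<le> 24 * (real ?d)\<^sup>2 * S * B"
        using S by (intro mult_left_mono B I) auto
      finally show "(\<Sum>i\<in>I. h i) \<le> 24 * (real ?d)\<^sup>2 * S * B" .
    qed (intro sum_nonneg h0)
    also have "\<dots> = ?C * S ^ ?d" by (simp add: power_mult_distrib mult_ac)
    finally show "(\<Sum>y\<in>F. fejer_prod S (x - y)) \<le> ?C * S ^ ?d" .
  qed
qed

text \<open>
  Both integrals become averages over \<open>F\<close>; the inner sum contributes \<open>C\<close> and one of the two
  normalizing factors \<open>1 / card F\<close> survives.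
\<close>

lemma uniform_measure_energy_le:
  fixes F :: "'a::euclidean_space set"
  assumes F: "finite F" "F \<noteq> {}" and S: "S > 0"
    and C: "\<And>x. (\<Sum>y\<in>F. fejer_prod S (x - y)) \<le> C"
  defines "\<mu> \<equiv> distr (measure_pmf (pmf_of_set F)) borel (\<lambda>x. x)"
  shows "prob_space \<mu>" and "sets \<mu> = sets borel" and "emeasure \<mu> (- F) = 0"
    and "(\<integral>p. fejer_prod S (fst p - snd p) \<partial>(\<mu> \<Otimes>\<^sub>M \<mu>)) \<le> C / card F"
proof -
  show prob: "prob_space \<mu>"
    unfolding \<mu>_def by (rule measure_pmf.prob_space_distr) simp
  show sets: "sets \<mu> = sets borel" by (simp add: \<mu>_def)
  note [measurable_cong] = sets
  interpret prob_space \<mu> by fact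
  interpret P: pair_prob_space \<mu> \<mu> ..
  have "- F \<in> sets borel" using F(1) by (simp add: finite_imp_closed)
  thus "emeasure \<mu> (- F) = 0"
    using F by (simp add: \<mu>_def emeasure_distr measure_pmf.emeasure_eq_measure measure_pmf_zero_iff)
  have I: "(\<integral>x. f x \<partial>\<mu>) = (\<Sum>x\<in>F. f x) / card F" if "f \<in> borel_measurable borel" for f :: "'a \<Rightarrow> real"
    unfolding \<mu>_def using F that by (subst integral_distr) (auto simp: integral_pmf_of_set)
  have "(\<integral>p. fejer_prod S (fst p - snd p) \<partial>(\<mu> \<Otimes>\<^sub>M \<mu>)) = (\<integral>x. (\<integral>y. fejer_prod S (x - y) \<partial>\<mu>) \<partial>\<mu>)"
    using P.integral_fst'[OF fejer_prod_integrable[OF prob sets S]] by simp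
  also have "\<dots> = (\<integral>x. (\<Sum>y\<in>F. fejer_prod S (x - y)) / card F \<partial>\<mu>)"
    by (subst I) (simp_all)
  also have "\<dots> = (\<Sum>x\<in>F. (\<Sum>y\<in>F. fejer_prod S (x - y)) / card F) / card F"
    by (rule I) measurable
  also have "\<dots> \<le> (\<Sum>x\<in>F. C / card F) / card F"
    by (intro divide_right_mono sum_mono C) auto
  also have "\<dots> = C / card F" using F by simp
  finally show "(\<integral>p. fejer_prod S (fst p - snd p) \<partial>(\<mu> \<Otimes>\<^sub>M \<mu>)) \<le> C / card F" .
qed

section \<open>Separated sets and covering numbers\<close>

text \<open>
  A separated subset of largest cardinality exists because a cover by finitely many balls of
  radius \<open>s/2\<close> bounds the cardinality of all of them: each ball contains at most one point.
  A point outside the balls of radius \<open>s\<close> could be added to it.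
\<close>

lemma ex_maximal_separated:
  fixes E :: "'a::euclidean_space set"
  assumes "E \<noteq> {}" "bounded E" and s: "s > 0"
  obtains F where "finite F" "F \<subseteq> E" "F \<noteq> {}"
    "pairwise (\<lambda>y y'. s \<le> dist y y') F" "E \<subseteq> (\<Union>y\<in>F. cball y s)"
proof -
  let ?sep = "\<lambda>F. finite F \<and> F \<subseteq> E \<and> pairwise (\<lambda>y y'. s \<le> dist y y') F"
  have "compact (closure E)" using assms by (simp add: compact_closure)
  hence "\<exists>K. finite K \<and> K \<subseteq> closure E \<and> closure E \<subseteq> (\<Union>x\<in>K. ball x (s/2))"
    using seq_compact_imp_totally_bounded[OF compact_imp_seq_compact, rule_format, of "closure E" "s/2"] s
    by simp
  then obtain K where K: "finite K" "closure E \<subseteq> (\<Union>x\<in>K. ball x (s/2))" by auto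
  have bound: "card F \<le> card K" if "?sep F" for F
  proof -
    have "\<exists>x\<in>K. y \<in> ball x (s/2)" if "y \<in> F" for y
      using that \<open>?sep F\<close> K(2) closure_subset[of E] by blast
    then obtain c where c: "\<And>y. y \<in> F \<Longrightarrow> c y \<in> K \<and> y \<in> ball (c y) (s/2)" by metis
    have "inj_on c F"
    proof (rule inj_onI, rule ccontr)
      fix y y' assume y: "y \<in> F" "y' \<in> F" "c y = c y'" "y \<noteq> y'"
      have "dist y y' < s"
        using c[OF y(1)] c[OF y(2)] y(3) dist_triangle_half_r[of "c y" y s y'] by simp
      thus False using pairwiseD[of _ F y y'] \<open>?sep F\<close> y by force
    qed
    thus ?thesis using c K(1) by (intro card_inj_on_le[of c]) auto
  qed
  obtain F where F: "?sep F" and max: "\<And>G. ?sep G \<Longrightarrow> card G \<le> card F"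
    using ex_has_greatest_nat[of ?sep "{}" card "Suc (card K)"] bound
    by (auto simp: less_Suc_eq_le)
  have cov: "E \<subseteq> (\<Union>y\<in>F. cball y s)"
  proof (rule ccontr)
    assume "\<not> ?thesis"
    then obtain x where x: "x \<in> E" "\<And>y. y \<in> F \<Longrightarrow> s < dist y x" by force
    hence "x \<notin> F" using s by force
    moreover have "?sep (insert x F)"
      using F x by (auto simp: pairwise_insert dist_commute less_imp_le)
    ultimately show False using max[of "insert x F"] F by simp
  qed
  hence "F \<noteq> {}" using assms(1) by auto
  thus ?thesis using that[of F] F cov by blast
qed

text \<open>
  In positive dimension a closed ball of radius \<open>r / 2\<close> has diameter exactly \<open>r\<close>, as the
  covering number demands.
\<close>

lemma covering_number_le_card:
  fixes E :: "(real ^ 'n) set"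
  assumes "finite F" "r \<ge> 0" "E \<subseteq> (\<Union>y\<in>F. cball y (r / 2))"
  shows "covering_number r E \<le> card F"
proof -
  have "covering_number r E \<le> card ((\<lambda>y. cball y (r / 2)) ` F)"
    unfolding covering_number_def using assms
    by (intro Least_le exI[of _ "(\<lambda>y. cball y (r / 2)) ` F"]) auto
  also have "\<dots> \<le> card F" by (rule card_image_le) fact
  finally show ?thesis .
qed

text \<open>
  The least number in the definition of the covering number ranges over a nonempty set when
  \<open>E\<close> is bounded, so it is realized by a cover.
\<close>

lemma covering_number_attained:
  fixes E :: "(real ^ 'n) set"
  assumes "E \<noteq> {}" "bounded E" "r > 0"
  obtains \<U> where "finite \<U>" "card \<U> = covering_number r E" "E \<subseteq> \<Union>\<U>"
    "\<forall>U\<in>\<U>. bounded U \<and> diameter U = r"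
proof -
  let ?P = "\<lambda>k. \<exists>\<U>. finite \<U> \<and> card \<U> = k \<and> (\<forall>U\<in>\<U>. bounded U \<and> diameter U = r) \<and> E \<subseteq> \<Union>\<U>"
  have "r / 2 > 0" using assms(3) by simp
  obtain F where F: "finite F" "F \<subseteq> E" "F \<noteq> {}"
      "pairwise (\<lambda>y y'. r / 2 \<le> dist y y') F"
      "E \<subseteq> (\<Union>y\<in>F. cball y (r / 2))"
    by (rule ex_maximal_separated[OF assms(1,2) \<open>r / 2 > 0\<close>]) (rule that)
  have "?P (card ((\<lambda>y. cball y (r / 2)) ` F))"
    using F(1,5) assms(3) by (intro exI[of _ "(\<lambda>y. cball y (r / 2)) ` F"]) auto
  hence "?P (covering_number r E)" unfolding covering_number_def by (rule LeastI)
  thus ?thesis using that by blast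
qed

lemma covering_number_pos:
  fixes E :: "(real ^ 'n) set"
  assumes "E \<noteq> {}" "bounded E" "r > 0"
  shows "covering_number r E > 0"
proof -
  obtain \<U> where \<U>: "finite \<U>" "card \<U> = covering_number r E" "E \<subseteq> \<Union>\<U>"
      "\<forall>U\<in>\<U>. bounded U \<and> diameter U = r"
    by (rule covering_number_attained[OF assms]) (rule that)
  with assms(1) have "\<U> \<noteq> {}" by auto
  with \<U>(1,2) show ?thesis by (metis card_gt_0_iff)
qed

section \<open>Minimal energy and covering number\<close>

lemma ball_energy_ge_covering:
  fixes E :: "(real ^ 'n) set"
  assumes E: "E \<noteq> {}" "bounded E" and borel: "E \<in> sets borel" and R: "R > 0"
    and "\<mu> \<in> prob_measures_on E"
  shows "(R / (2 * CARD('n))) ^ CARD('n) / covering_number (1 / R) E \<le> ball_energy \<mu> R"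
proof -
  have \<mu>: "prob_space \<mu>" "sets \<mu> = sets borel" "emeasure \<mu> (UNIV - E) = 0"
    using assms(5) by (auto simp: prob_measures_on_def)
  have "1 / R > 0" using R by simp
  obtain \<U> where \<U>: "finite \<U>" "card \<U> = covering_number (1 / R) E" "E \<subseteq> \<Union>\<U>"
      "\<forall>U\<in>\<U>. bounded U \<and> diameter U = 1 / R"
    by (rule covering_number_attained[OF E \<open>1 / R > 0\<close>]) (rule that)
  have "AE x in \<mu>. x \<in> E"
    using \<mu> borel by (intro AE_I[of _ _ "UNIV - E"]) auto
  hence "AE x in \<mu>. x \<in> \<Union>\<U>"
    by eventually_elim (use \<U>(3) in auto)
  from ball_energy_ge[OF \<mu>(1,2) R \<U>(1) _ this] \<U>(4)
  show ?thesis unfolding \<U>(2) by simp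
qed

lemma ex_ball_energy_le_covering:
  "\<exists>C>0. \<forall>E :: (real ^ 'n) set. \<forall>R>0. E \<noteq> {} \<longrightarrow> bounded E \<longrightarrow>
     (\<exists>\<mu>\<in>prob_measures_on E. ball_energy \<mu> R \<le> C * R ^ CARD('n) / covering_number (1 / R) E)"
proof -
  let ?d = "CARD('n)"
  obtain C where C: "C > 0" "\<forall>S>0. \<forall>F. \<forall>x::real ^ 'n. finite F \<longrightarrow>
      pairwise (\<lambda>y y'. 1 \<le> S * dist y y') F \<longrightarrow>
      (\<Sum>y\<in>F. fejer_prod S (x - y)) \<le> C * S ^ DIM(real ^ 'n)"
    using sum_fejer_prod_le[where 'a="real ^ 'n"] by (elim exE conjE) (rule that)
  show ?thesis
  proof (intro exI[of _ "4 ^ ?d * C"] conjI allI impI)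
    show "4 ^ ?d * C > 0" using C(1) by simp
    fix E :: "(real ^ 'n) set" and R :: real
    assume E: "E \<noteq> {}" "bounded E" and R: "R > 0"
    define N where "N = real (covering_number (1 / R) E)"
    have N: "N > 0" using covering_number_pos[OF E, of "1 / R"] R by (simp add: N_def)
    have "1 / R / 2 > 0" using R by simp
    obtain F where F: "finite F" "F \<subseteq> E" "F \<noteq> {}"
      "pairwise (\<lambda>y y'. 1 / R / 2 \<le> dist y y') F"
      "E \<subseteq> (\<Union>y\<in>F. cball y (1 / R / 2))"
      by (rule ex_maximal_separated[OF E \<open>1 / R / 2 > 0\<close>]) (rule that)
    \<comment> \<open>The scale \<open>S = 2 R\<close> serves twice: the points of \<open>F\<close> are \<open>1/S\<close>-separated, and the tents of half-width \<open>S\<close> dominate the ball of radius \<open>R\<close> up to a constant.\<close>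
    define \<mu> where "\<mu> = distr (measure_pmf (pmf_of_set F)) borel (\<lambda>x. x)"
    have R2: "2 * R > 0" using R by simp
    have sep: "pairwise (\<lambda>y y'. 1 \<le> 2 * R * dist y y') F"
      using F(4) by (rule pairwise_mono) (use R in \<open>auto simp: field_simps\<close>)
    note \<mu> = uniform_measure_energy_le[OF F(1,3) R2 C(2)[rule_format, OF R2 F(1) sep], folded \<mu>_def]
    have NF: "N \<le> card F"
      using covering_number_le_card[OF F(1) _ F(5)] R by (simp add: N_def)
    have "ball_energy \<mu> R \<le> 2 ^ ?d * (\<integral>p. fejer_prod (2 * R) (fst p - snd p) \<partial>(\<mu> \<Otimes>\<^sub>M \<mu>))"
      by (rule ball_energy_le[OF \<mu>(1,2) R])
    also have "\<dots> \<le> 2 ^ ?d * (C * (2 * R) ^ DIM(real ^ 'n) / card F)"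
      by (intro mult_left_mono \<mu>(4)) auto
    also have "\<dots> \<le> 2 ^ ?d * (C * (2 * R) ^ DIM(real ^ 'n) / N)"
      using NF R C(1) N by (intro mult_left_mono divide_left_mono mult_pos_pos) auto
    also have "\<dots> = 4 ^ ?d * C * R ^ ?d / N"
    proof -
      have "(4::real) ^ ?d = 2 ^ ?d * 2 ^ ?d" by (simp flip: power_mult_distrib)
      thus ?thesis by (simp add: power_mult_distrib)
    qed
    finally have le: "ball_energy \<mu> R \<le> 4 ^ ?d * C * R ^ ?d / N" .
    have "emeasure \<mu> (UNIV - E) \<le> emeasure \<mu> (- F)"
      using F(1,2) \<mu>(2) by (intro emeasure_mono) (auto simp: finite_imp_closed)
    hence "\<mu> \<in> prob_measures_on E"
      using \<mu>(1-3) by (simp add: prob_measures_on_def)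
    with le show "\<exists>\<mu>\<in>prob_measures_on E. ball_energy \<mu> R \<le> 4 ^ ?d * C * R ^ ?d / covering_number (1 / R) E"
      unfolding N_def by blast
  qed
qed

section \<open>Box dimensions\<close>

lemma
  fixes f g :: "'a \<Rightarrow> real"
  assumes F: "F \<noteq> bot" and lim: "((\<lambda>x. f x - g x) \<longlongrightarrow> 0) F"
  shows Liminf_eq_if_diff_tendsto_0: "Liminf F (\<lambda>x. ereal (f x)) = Liminf F (\<lambda>x. ereal (g x))"
    and Limsup_eq_if_diff_tendsto_0: "Limsup F (\<lambda>x. ereal (f x)) = Limsup F (\<lambda>x. ereal (g x))"
proof -
  have ev: "eventually (\<lambda>x. ereal (u x) \<le> ereal (v x) + ereal e) F"
    if "((\<lambda>x. u x - v x) \<longlongrightarrow> 0) F" "e > 0" for e and u v :: "'a \<Rightarrow> real"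
    using order_tendstoD(2)[OF that] by eventually_elim simp
  have li: "Liminf F (\<lambda>x. ereal (u x)) \<le> Liminf F (\<lambda>x. ereal (v x))"
    if "((\<lambda>x. u x - v x) \<longlongrightarrow> 0) F" for u v :: "'a \<Rightarrow> real"
  proof (rule ereal_le_epsilon2)
    fix e :: real assume "e > 0"
    from Liminf_mono[OF ev[OF that this]]
    show "Liminf F (\<lambda>x. ereal (u x)) \<le> Liminf F (\<lambda>x. ereal (v x)) + ereal e"
      using F by (simp add: Liminf_add_ereal_right del: plus_ereal.simps)
  qed
  have ls: "Limsup F (\<lambda>x. ereal (u x)) \<le> Limsup F (\<lambda>x. ereal (v x))"
    if "((\<lambda>x. u x - v x) \<longlongrightarrow> 0) F" for u v :: "'a \<Rightarrow> real"
  proof (rule ereal_le_epsilon2)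
    fix e :: real assume "e > 0"
    from Limsup_mono[OF ev[OF that this]]
    show "Limsup F (\<lambda>x. ereal (u x)) \<le> Limsup F (\<lambda>x. ereal (v x)) + ereal e"
      using F by (simp add: Limsup_add_ereal_right del: plus_ereal.simps)
  qed
  have lim': "((\<lambda>x. g x - f x) \<longlongrightarrow> 0) F"
    using tendsto_minus[OF lim] by simp
  show "Liminf F (\<lambda>x. ereal (f x)) = Liminf F (\<lambda>x. ereal (g x))"
    by (intro antisym li lim lim')
  show "Limsup F (\<lambda>x. ereal (f x)) = Limsup F (\<lambda>x. ereal (g x))"
    by (intro antisym ls lim lim')
qed

theorem corollary4p2:
  fixes E :: "(real ^ 'n) set"
  assumes "E \<noteq> {}" and "bounded E" and "E \<in> sets borel"
  shows "lower_box_dim E =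
      Liminf at_top (\<lambda>R::real. ereal (ln (R powr (- real CARD('n)) *
        (INF \<mu>\<in>prob_measures_on E. LINT z:cball 0 R|lborel. (cmod (fourier_measure \<mu> z))\<^sup>2))
        / (- ln R)))
    \<and> upper_box_dim E =
      Limsup at_top (\<lambda>R::real. ereal (ln (R powr (- real CARD('n)) *
        (INF \<mu>\<in>prob_measures_on E. LINT z:cball 0 R|lborel. (cmod (fourier_measure \<mu> z))\<^sup>2))
        / (- ln R)))"
proof -
  let ?d = "CARD('n)"
  obtain C :: real where C: "C > 0" "\<forall>E :: (real ^ 'n) set. \<forall>R>0. E \<noteq> {} \<longrightarrow> bounded E \<longrightarrow>
      (\<exists>\<mu>\<in>prob_measures_on E. ball_energy \<mu> R \<le> C * R ^ ?d / covering_number (1 / R) E)"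
    using ex_ball_energy_le_covering[where 'n='n] by (elim exE conjE) (rule that)
  define c :: real where "c = (1 / (2 * ?d)) ^ ?d"
  have c: "c > 0" by (simp add: c_def)
  define N where "N R = real (covering_number (1 / R) E)" for R
  define q where "q R = R powr (- real CARD('n)) * (INF \<mu>\<in>prob_measures_on E. ball_energy \<mu> R)" for R
  have N: "N R > 0" if "R > 0" for R
    using covering_number_pos[OF assms(1,2), of "1 / R"] that by (simp add: N_def)
  \<comment> \<open>The normalized minimal energy \<open>q R\<close> is comparable to \<open>1 / N R\<close>.\<close>
  have bounds: "c \<le> q R * N R \<and> q R * N R \<le> C" if R: "R > 0" for R
  proof -
    let ?e = "INF \<mu>\<in>prob_measures_on E. ball_energy \<mu> R"
    obtain \<mu> where \<mu>: "\<mu> \<in> prob_measures_on E" "ball_energy \<mu> R \<le> C * R ^ ?d / N R"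
      using C(2)[rule_format, OF R assms(1,2)] by (auto simp: N_def)
    have q: "q R = ?e / R ^ ?d"
      using R by (simp add: q_def powr_minus powr_realpow divide_inverse mult.commute)
    have "0 \<le> ball_energy \<nu> R" for \<nu> :: "(real ^ 'n) measure"
      unfolding set_lebesgue_integral_def by (rule Bochner_Integration.integral_nonneg) simp
    hence "bdd_below ((\<lambda>\<mu>. ball_energy \<mu> R) ` prob_measures_on E)"
      by (intro bdd_belowI[of _ 0]) auto
    hence "?e \<le> C * R ^ ?d / N R"
      by (rule cINF_lower2[where x=\<mu>]) (rule \<mu>)+
    hence upper: "q R * N R \<le> C"
      using R N[OF R] by (simp add: q field_simps)
    have "(R / (2 * ?d)) ^ ?d / N R \<le> ?e"
      using \<mu>(1) ball_energy_ge_covering[OF assms R] unfolding N_def by (intro cINF_greatest) auto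
    hence "c \<le> q R * N R"
      using R N[OF R] by (simp add: q c_def field_simps power_mult_distrib power_divide)
    with upper show ?thesis by simp
  qed
  \<comment> \<open>Comparability up to constants changes the quotients of logarithms by at most a constant over \<open>ln R\<close>.\<close>
  let ?K = "max \<bar>ln c\<bar> \<bar>ln C\<bar>"
  have "((\<lambda>R. ln (N R) / ln R - ln (q R) / (- ln R)) \<longlongrightarrow> 0) at_top"
  proof (rule Lim_null_comparison)
    show "((\<lambda>R::real. ?K / ln R) \<longlongrightarrow> 0) at_top"
      by (intro tendsto_divide_0[OF tendsto_const] filterlim_at_top_imp_at_infinity ln_at_top)
    show "eventually (\<lambda>R. norm (ln (N R) / ln R - ln (q R) / (- ln R)) \<le> ?K / ln R) at_top"
      using eventually_gt_at_top[of 1]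
    proof eventually_elim
      case (elim R)
      have b: "c \<le> q R * N R" "q R * N R \<le> C" using bounds[of R] elim by simp_all
      have "q R > 0" using b(1) c N[of R] elim by (smt (verit) mult_nonpos_nonneg)
      hence "ln (N R) / ln R - ln (q R) / (- ln R) = ln (q R * N R) / ln R"
        using N[of R] elim by (simp add: ln_mult add_divide_distrib)
      moreover have "\<bar>ln (q R * N R)\<bar> \<le> ?K"
        using b c ln_mono[of c "q R * N R"] ln_mono[of "q R * N R" C] by linarith
      ultimately show ?case using elim by (simp add: divide_right_mono)
    qed
  qed
  note eqs = Liminf_eq_if_diff_tendsto_0[OF _ this] Limsup_eq_if_diff_tendsto_0[OF _ this]
  \<comment> \<open>The substitution \<open>r = 1 / R\<close> carries the limit \<open>r \<rightarrow> 0\<close> from the right to \<open>R \<rightarrow> \<infinity>\<close>.\<close>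
  have inv: "ln (real (covering_number (inverse R) E)) / - ln (inverse R) = ln (N R) / ln R"
    if "R > 0" for R using that by (simp add: N_def ln_inverse divide_inverse)
  have "lower_box_dim E = Liminf at_top (\<lambda>R. ereal (ln (real (covering_number (inverse R) E)) / - ln (inverse R)))"
    unfolding lower_box_dim_def at_right_to_top by (rule Liminf_filtermap_eq) (simp add: inj_def)
  also have "\<dots> = Liminf at_top (\<lambda>R. ereal (ln (N R) / ln R))"
    by (intro Liminf_eq eventually_mono[OF eventually_gt_at_top[of 0]]) (simp only: inv)
  finally have low: "lower_box_dim E = Liminf at_top (\<lambda>R. ereal (ln (q R) / (- ln R)))"
    using eqs(1) by simp
  have "upper_box_dim E = Limsup at_top (\<lambda>R. ereal (ln (real (covering_number (inverse R) E)) / - ln (inverse R)))"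
    unfolding upper_box_dim_def at_right_to_top by (rule Limsup_filtermap_eq) (simp add: inj_def)
  also have "\<dots> = Limsup at_top (\<lambda>R. ereal (ln (N R) / ln R))"
    by (intro Limsup_eq eventually_mono[OF eventually_gt_at_top[of 0]]) (simp only: inv)
  finally have up: "upper_box_dim E = Limsup at_top (\<lambda>R. ereal (ln (q R) / (- ln R)))"
    using eqs(2) by simp
  show ?thesis using low up unfolding q_def by blast
qed

end
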